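(* Let $d$ range over the odd positive integers and set $\gamma(d)=\max_{k\mid d}\phi(k)$, where $\phi$ is Euler's totient function; then $\gamma(d)\leq d-1$ (for $d>1$), with equality whenever $d$ is an odd prime. Let $p$ range over primes with $p\equiv 1\pmod{2d}$. Then $$\mathcal{A}(p,d)=\frac{2d+1}{6}p+O\!\left(d(\log p)^2p^{1-1/\gamma(d)}\right),$$ where the implied constant is absolute. In particular, if $d\leq c\frac{\log p}{\log\log p}$ with a fixed $c<1/2$, then $\mathcal{A}(p,d)\sim\frac{2d+1}{6}p$ as $p\to\infty$.
   Context: For an odd prime $p$ and an odd $d$ with $p\equiv1\pmod{2d}$, let $m=(p-1)/d$ and let $\chi$ be an odd Dirichlet character modulo $p$ of order $m$. Define $$\mathcal{A}(p,d)=\frac{1}{p-1}\sum_{N=1}^{p-1}\#\{(n_1,n_2):1\le n_1,n_2\le N,\ \chi(n_1)=\chi(n_2)\}$$ (independent of the choice of $\chi$). *)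

theory Defs
  imports "HOL-Analysis.Analysis" "HOL-Number_Theory.Number_Theory"
begin

definition dirichlet_char :: "nat \<Rightarrow> (nat \<Rightarrow> complex) \<Rightarrow> bool" where
  "dirichlet_char p chi \<longleftrightarrow>
     chi 1 = 1 \<and> (\<forall>a b. chi (a * b) = chi a * chi b) \<and> (\<forall>a. chi (a + p) = chi a) \<and>
     (\<forall>a. chi a = 0 \<longleftrightarrow> p dvd a)"

text \<open>Odd character: chi(-1) = -1, with -1 represented by p - 1.\<close>
definition odd_char :: "nat \<Rightarrow> (nat \<Rightarrow> complex) \<Rightarrow> bool" where
  "odd_char p chi \<longleftrightarrow> chi (p - 1) = -1"

definition char_order :: "nat \<Rightarrow> (nat \<Rightarrow> complex) \<Rightarrow> nat" where
  "char_order p chi = (LEAST k. k > 0 \<and> (\<forall>n. coprime n p \<longrightarrow> chi n ^ k = 1))"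

text \<open>The average A(p,d), computed from the chosen character chi (of order (p-1)/d).\<close>
definition cA :: "nat \<Rightarrow> (nat \<Rightarrow> complex) \<Rightarrow> real" where
  "cA p chi = (1 / real (p - 1)) *
     (\<Sum>N = 1..p - 1. real (card {(n1, n2). n1 \<in> {1..N} \<and> n2 \<in> {1..N} \<and> chi n1 = chi n2}))"

definition gamma :: "nat \<Rightarrow> nat" where
  "gamma d = Max {totient k | k. k dvd d}"

end

(*
  Two integers have the same nonzero character value iff their ratio mod p lies in the kernel of
  chi, the group H of the d-th roots of unity mod p. Hence the number of pairs for N is the sum
  over h in H of the number S_h(N) of n in [1, N] with h n mod p in [1, N]. The term h = 1
  gives N; for h <> 1 one has S_h(N) = N^2/p + O(p^(1 - 1/gamma(d))), and summing over N gives the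
  theorem even without the factor (log p)^2.

  For the estimate of S_h(N), take by Thue's lemma a short nonzero vector (q, b) of the lattice
  b = h q (mod p), with |b| <= q <= sqrt p after possibly replacing h by its inverse. On a block of
  q consecutive n the residues h n are close to equally spaced, so each block counts q N/p + O(1) of
  them and the total error is O(p/q). On the other hand p divides b^d - q^d, which is the product of
  the norms of b - zeta_j q over j | d. Since h <> 1, p divides the norm for some j > 1; it
  is a nonzero integer because j is odd, and its absolute value is at most (2 q)^phi(j), whence
  2 q >= p^(1/gamma(d)).
*)
theory Submission
  imports Defs "HOL-Computational_Algebra.Fundamental_Theorem_Algebra" "HOL-Library.Discrete_Functions"
begin

subsection \<open>Residues of a dilation on a block\<close>

text \<open>The multiples correspond to the integers from the ceiling of \<open>lo / p\<close>,
  written \<open>- ((- lo) div p)\<close>, to the floor of \<open>hi / p\<close>. The lower bound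
  also covers \<open>hi < lo\<close>, where its right-hand side is negative; the inner interval in
  the block count below can be of this kind.\<close>

lemma card_multiples_in_interval:
  fixes p lo hi :: int
  assumes "p > 0"
  shows "finite {r. lo \<le> r * p \<and> r * p \<le> hi}"
    and "real (card {r. lo \<le> r * p \<and> r * p \<le> hi}) \<ge> real_of_int (hi - lo) / real_of_int p - 1"
    and "lo \<le> hi \<Longrightarrow>
      real (card {r. lo \<le> r * p \<and> r * p \<le> hi}) \<le> real_of_int (hi - lo) / real_of_int p + 1"
proof -
  have 1: "r * p \<le> hi \<longleftrightarrow> r \<le> hi div p" for r hi
  proof
    assume "r * p \<le> hi"
    hence "r * p div p \<le> hi div p" using assms by (intro zdiv_mono1)
    thus "r \<le> hi div p" using assms by simp
  next
    assume "r \<le> hi div p"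
    hence "r * p \<le> hi div p * p" using assms by (intro mult_right_mono) auto
    also have "\<dots> \<le> hi" using assms by (metis div_mult_mod_eq le_add_same_cancel1 pos_mod_sign)
    finally show "r * p \<le> hi" .
  qed
  have 2: "lo \<le> r * p \<longleftrightarrow> - ((- lo) div p) \<le> r" for r
    using 1[of "-r" "-lo"] by auto
  have A: "{r. lo \<le> r * p \<and> r * p \<le> hi} = {- ((- lo) div p)..hi div p}"
    using 1 2 by auto
  show "finite {r. lo \<le> r * p \<and> r * p \<le> hi}" unfolding A by simp
  have b: "real_of_int (x div p) \<le> real_of_int x / real_of_int p"
      "real_of_int (x div p) \<ge> real_of_int x / real_of_int p - 1" for x
    using real_of_int_div4[of x p] real_of_int_div3[of x p] by linarith+
  show "real (card {r. lo \<le> r * p \<and> r * p \<le> hi}) \<ge> real_of_int (hi - lo) / real_of_int p - 1"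
    unfolding A using b(2)[of hi] b(2)[of "-lo"] by (simp add: diff_divide_distrib)
  assume "lo \<le> hi"
  hence "real_of_int lo / real_of_int p \<le> real_of_int hi / real_of_int p"
    using assms by (simp add: divide_right_mono)
  thus "real (card {r. lo \<le> r * p \<and> r * p \<le> hi}) \<le> real_of_int (hi - lo) / real_of_int p + 1"
    unfolding A using b(1)[of hi] b(1)[of "-lo"] by (simp add: diff_divide_distrib)
qed

lemma card_block_residues:
  fixes h q a b p N x :: int
  assumes q: "q > 0" and p: "p > 0" and cop: "coprime a q" and h: "h * q = a * p + b"
    and qb: "q * \<bar>b\<bar> \<le> p" and qp: "q \<le> p" and N: "1 \<le> N" "N < p"
  shows "\<bar>real (card {j\<in>{0..<q}. (x + h * j) mod p \<in> {1..N}}) - of_int q * of_int N / of_int p\<bar> \<le> 4"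
proof -
  \<comment> \<open>If \<open>y\<close> is the residue of \<open>x + h * j\<close>, then \<open>q * y = x * q + f j * p + j * b\<close>, where \<open>f j\<close> is
    congruent to \<open>j * a\<close> mod \<open>q\<close>; as \<open>\<bar>j * b\<bar> \<le> p\<close>, the residues are counted by the multiples
    \<open>f j * p\<close> in an interval of length about \<open>q * N\<close>.\<close>
  define A where "A = {j\<in>{0..<q}. (x + h * j) mod p \<in> {1..N}}"
  define f where "f = (\<lambda>j. j * a - q * ((x + h * j) div p))"
  have finA: "finite A" unfolding A_def by (rule finite_subset[of _ "{0..<q}"]) auto
  have key: "q * ((x + h * j) mod p) = x * q + f j * p + j * b" for j
  proof -
    define D where "D = (x + h * j) div p"
    have "(x + h * j) mod p = x + h * j - p * D"
      by (simp add: D_def minus_mult_div_eq_mod)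
    hence "q * ((x + h * j) mod p) = q * (x + h * j - p * D)"
      by simp
    also have "\<dots> = x * q + (h * q) * j - q * D * p"
      by (simp add: algebra_simps)
    also have "\<dots> = x * q + (j * a - q * D) * p + j * b"
      unfolding h by (simp add: algebra_simps)
    finally show ?thesis unfolding f_def D_def .
  qed
  have jb: "\<bar>j * b\<bar> \<le> p" if "j \<in> {0..<q}" for j
  proof -
    have "\<bar>j * b\<bar> \<le> q * \<bar>b\<bar>" using that by (auto simp: abs_mult intro: mult_right_mono)
    thus ?thesis using qb by simp
  qed
  \<comment> \<open>As \<open>f j\<close> is congruent to \<open>j * a\<close> mod \<open>q\<close>
    and \<open>a\<close> is invertible mod \<open>q\<close>, the value \<open>f j\<close> determines
    \<open>j\<close> among \<open>q\<close> consecutive integers.\<close>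
  have inj: "inj_on f A"
  proof (rule inj_onI)
    fix i j assume ij: "i \<in> A" "j \<in> A" "f i = f j"
    have "q dvd (i - j) * a"
    proof -
      have "(i - j) * a = q * ((x + h * i) div p - (x + h * j) div p)"
        using ij(3) by (simp add: f_def algebra_simps)
      thus ?thesis by simp
    qed
    hence "q dvd i - j" using cop by (simp add: coprime_commute coprime_dvd_mult_left_iff)
    moreover have "\<bar>i - j\<bar> < q" using ij unfolding A_def by auto
    ultimately have "i - j = 0" using dvd_imp_le_int by (metis abs_of_pos q not_less)
    thus "i = j" by simp
  qed
  \<comment> \<open>The perturbation \<open>j * b\<close> moves the endpoints by at most
    \<open>p\<close>: widening the interval by \<open>p\<close> on each side captures every value of
    \<open>f\<close> on \<open>A\<close>, and shrinking it by \<open>p\<close> leaves only such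
    values.\<close>
  let ?U = "{r. q - x * q - p \<le> r * p \<and> r * p \<le> q * N - x * q + p}"
  let ?L = "{r. q - x * q + p \<le> r * p \<and> r * p \<le> q * N - x * q - p}"
  have qN: "q \<le> q * N" using q N by simp
  have sub1: "f ` A \<subseteq> ?U"
  proof safe
    fix j assume j: "j \<in> A"
    have "q * ((x + h * j) mod p) \<ge> q * 1" "q * ((x + h * j) mod p) \<le> q * N"
      using j q unfolding A_def by (intro mult_left_mono; auto)+
    moreover have "\<bar>j * b\<bar> \<le> p" using jb j unfolding A_def by blast
    ultimately show "q - x * q - p \<le> f j * p" "f j * p \<le> q * N - x * q + p"
      using key[of j] by linarith+
  qed
  have sub2: "?L \<subseteq> f ` A"
  proof
    fix r assume r: "r \<in> ?L"
    \<comment> \<open>A preimage of \<open>r\<close> has to satisfy \<open>j * a \<equiv> r\<close>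
      mod \<open>q\<close>, so the inverse of \<open>a\<close> produces it.\<close>
    obtain a' where a': "[a * a' = 1] (mod q)"
      using cop cong_solve_coprime_int by blast
    define j where "j = (a' * r) mod q"
    have jq: "j \<in> {0..<q}" using q by (simp add: j_def)
    have "[j * a = (a * a') * r] (mod q)"
      unfolding j_def cong_def by (metis mod_mult_left_eq mult.commute mult.assoc)
    also have "[(a * a') * r = 1 * r] (mod q)" using a' by (rule cong_scalar_right)
    finally have "q dvd j * a - r" by (simp add: cong_iff_dvd_diff)
    then obtain s where s: "j * a - r = q * s" by (elim dvdE)
    define y where "y = x + h * j - s * p"
    have "q * y = x * q + (h * q) * j - q * s * p" by (simp add: y_def algebra_simps)
    also have "\<dots> = x * q + (j * a - q * s) * p + j * b" unfolding h by (simp add: algebra_simps)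
    also have "j * a - q * s = r" using s by simp
    finally have y: "q * y = x * q + r * p + j * b" .
    have "q * 1 \<le> q * y" "q * y \<le> q * N" using r jb[OF jq] unfolding y by auto
    hence y1: "1 \<le> y" "y \<le> N" using q by (auto simp: mult_le_cancel_left)
    have ymod: "(x + h * j) mod p = y"
      using y1 N by (intro int_mod_pos_eq[where q = s]) (auto simp: y_def)
    have ydiv: "(x + h * j) div p = s"
      using y1 N by (intro int_div_pos_eq[where r = y]) (auto simp: y_def)
    have "f j = r" unfolding f_def ydiv using s by simp
    moreover have "j \<in> A" unfolding A_def using jq ymod y1 by simp
    ultimately show "r \<in> f ` A" by blast
  qed
  have cA: "card A = card (f ` A)" using inj by (simp add: card_image)
  have "card A \<le> card ?U" unfolding cA
    by (intro card_mono card_multiples_in_interval(1) p sub1)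
  hence "real (card A) \<le> real_of_int ((q * N - x * q + p) - (q - x * q - p)) / real_of_int p + 1"
    using card_multiples_in_interval(3)[OF p, of "q - x * q - p" "q * N - x * q + p"] qN p by linarith
  also have "\<dots> \<le> of_int q * of_int N / of_int p + 4"
    using p q by (simp add: field_simps)
  finally have upper: "real (card A) \<le> of_int q * of_int N / of_int p + 4" .
  have "card ?L \<le> card A" unfolding cA
    by (intro card_mono finite_imageI finA sub2)
  hence "real (card A) \<ge> real_of_int ((q * N - x * q - p) - (q - x * q + p)) / real_of_int p - 1"
    using card_multiples_in_interval(2)[OF p, of "q * N - x * q - p" "q - x * q + p"] by linarith
  \<comment> \<open>The shrunken interval has length \<open>q * N - q - 2 * p\<close>, so the total
    loss is \<open>3 + q / p\<close>, at most 4 because \<open>q \<le> p\<close>.\<close>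
  moreover have "of_int q * of_int N / of_int p - 4
      \<le> real_of_int ((q * N - x * q - p) - (q - x * q + p)) / real_of_int p - 1"
    using p qp by (simp add: field_simps)
  ultimately have "of_int q * of_int N / of_int p - 4 \<le> real (card A)"
    by (rule order_trans[rotated])
  thus ?thesis using upper unfolding A_def[symmetric] by (intro abs_leI) auto
qed

subsection \<open>Norms of cyclotomic linear forms\<close>

text \<open>The cyclotomic polynomial, given by its complex roots so that its degree and the size of
  its values can be read off; that its coefficients are integers is proved separately.\<close>

definition cyclo :: "nat \<Rightarrow> complex poly" where
  "cyclo n = (\<Prod>i\<in>totatives n. [:- cis (2 * pi * real i / real n), 1:])"

lemma lead_coeff_cyclo [simp]: "lead_coeff (cyclo n) = 1"
  unfolding cyclo_def by (simp add: lead_coeff_prod)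

lemma degree_cyclo: "degree (cyclo n) = totient n"
proof -
  have "degree (cyclo n) = (\<Sum>i\<in>totatives n. degree [:- cis (2 * pi * real i / real n), 1:])"
    unfolding cyclo_def by (intro degree_prod_eq_sum_degree) auto
  thus ?thesis by (simp add: totient_def)
qed

text \<open>\<open>X^n - 1\<close> is squarefree, hence the product of \<open>X - z\<close> over all
  \<open>n\<close>-th roots of unity \<open>z\<close>. Sorting the exponents \<open>k\<close> by
  \<open>gcd k n = j\<close> groups the roots into the primitive roots of order
  \<open>n div j\<close>.\<close>

lemma prod_cyclo:
  assumes n: "n > 0"
  shows "(\<Prod>j | j dvd n. cyclo j) = Polynomial.monom 1 n - 1"
proof -
  define f where "f = (\<lambda>k::nat. [:- cis (2 * pi * real k / real n), 1:])"
  define A where "A = (\<lambda>j. {k\<in>{0<..n}. gcd k n = j})"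
  define P :: "complex poly" where "P = Polynomial.monom 1 n - 1"
  have poly_P: "poly P z = z ^ n - 1" for z by (simp add: P_def poly_monom)
  have "poly (pderiv P) z \<noteq> 0" if "poly P z = 0" for z
  proof -
    have "z \<noteq> 0" using that n by (auto simp: poly_P power_0_left)
    thus ?thesis using n by (simp add: P_def pderiv_diff pderiv_monom poly_monom)
  qed
  hence rsq: "rsquarefree P" by (auto simp: rsquarefree_roots)
  have "degree P = n \<and> lead_coeff P = 1"
  proof -
    have "degree P = n"
      using n degree_add_eq_left[of "-1" "Polynomial.monom 1 n :: complex poly"]
      by (simp add: P_def degree_monom_eq)
    thus ?thesis using n by (simp add: P_def)
  qed
  hence "P = (\<Prod>z|poly P z = 0. [:-z, 1:])"
    using complex_poly_decompose_rsquarefree[OF rsq] by (metis smult_1_left)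
  also have "{z. poly P z = 0} = {z. z ^ n = 1}" by (simp add: poly_P)
  also have "(\<Prod>z|z ^ n = 1. [:-z, 1:]) = (\<Prod>k<n. f k)"
    unfolding f_def using prod.reindex_bij_betw[OF Complex.bij_betw_roots_unity[OF n], of "\<lambda>z. [:-z, 1:]"]
    by simp
  \<comment> \<open>Exponents 0 and \<open>n\<close> give the same root 1; the range is shifted to
    \<open>{0<..n}\<close> to match the sets on which \<open>totatives\<close> and the partition by
    gcd are defined.\<close>
  also have "\<dots> = (\<Prod>k\<in>{0<..n}. f k)"
  proof (rule prod.reindex_bij_witness[of _ "\<lambda>k. if k = n then 0 else k" "\<lambda>k. if k = 0 then n else k"])
    fix k assume "k \<in> {..<n}"
    show "f (if k = 0 then n else k) = f k" using n by (simp add: f_def)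
  qed (use n in \<open>auto split: if_splits\<close>)
  also have "{0<..n} = (\<Union>j\<in>{j. j dvd n}. A j)" by (auto simp: A_def)
  also have "prod f \<dots> = (\<Prod>j | j dvd n. prod f (A j))"
    using n by (intro prod.UNION_disjoint) (auto simp: A_def)
  also have "\<dots> = (\<Prod>j | j dvd n. cyclo (n div j))"
  proof (rule prod.cong)
    fix j assume "j \<in> {j. j dvd n}"
    hence j: "j dvd n" by simp
    have "prod f (A j) = (\<Prod>i\<in>totatives (n div j). f (i * j))"
      unfolding A_def
      by (rule prod.reindex_bij_betw[OF bij_betw_totatives_gcd_eq[OF j n], symmetric])
    also have "\<dots> = cyclo (n div j)"
      unfolding cyclo_def f_def using j n
      by (intro prod.cong refl) (auto elim!: dvdE simp: field_simps)
    finally show "prod f (A j) = cyclo (n div j)" .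
  qed simp
  also have "\<dots> = (\<Prod>j | j dvd n. cyclo j)" using n
    by (intro prod.reindex_bij_witness[of _ "(div) n" "(div) n"]) (auto elim: dvdE)
  finally show ?thesis by (simp add: P_def)
qed

section \<open>Integrality of the coefficients of cyclotomic polynomials\<close>

lemma coeff_mult_Ints:
  fixes f g :: "'a :: comm_ring_1 poly"
  assumes "\<And>i. Polynomial.coeff f i \<in> \<int>" "\<And>i. Polynomial.coeff g i \<in> \<int>"
  shows "Polynomial.coeff (f * g) i \<in> \<int>"
  unfolding coeff_mult by (intro Ints_sum Ints_mult assms)

lemma coeff_prod_Ints:
  fixes f :: "'b \<Rightarrow> 'a :: comm_ring_1 poly"
  assumes "\<And>x i. x \<in> A \<Longrightarrow> Polynomial.coeff (f x) i \<in> \<int>"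
  shows "Polynomial.coeff (prod f A) i \<in> \<int>"
  using assms
proof (induction A arbitrary: i rule: infinite_finite_induct)
  case (insert x A)
  thus ?case by (auto intro!: coeff_mult_Ints)
qed (auto simp: coeff_1)

text \<open>Division by a monic polynomial, from the top coefficient downwards: the coefficient of
  \<open>f * g\<close> at \<open>k + degree g\<close> is the \<open>k\<close>-th coefficient of
  \<open>f\<close> plus terms with higher coefficients of \<open>f\<close>, already known to be
  integers.\<close>

lemma coeff_quotient_monic_Ints:
  fixes f g :: "'a :: comm_ring_1 poly"
  assumes g: "lead_coeff g = 1" "\<And>i. Polynomial.coeff g i \<in> \<int>" and fg: "\<And>i. Polynomial.coeff (f * g) i \<in> \<int>"
  shows "Polynomial.coeff f k \<in> \<int>"
proof (induction "degree f - k" arbitrary: k rule: less_induct)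
  case less
  show ?case
  proof (cases "k > degree f")
    case True
    thus ?thesis by (simp add: coeff_eq_0)
  next
    case False
    define m where "m = degree g"
    have IH: "Polynomial.coeff f i \<in> \<int>" if "i > k" for i
      using less[of i] that False by (cases "i > degree f") (auto simp: coeff_eq_0)
    have "Polynomial.coeff (f * g) (k + m) = (\<Sum>i\<le>k + m. Polynomial.coeff f i * Polynomial.coeff g (k + m - i))"
      by (simp add: coeff_mult)
    also have "\<dots> = Polynomial.coeff f k * Polynomial.coeff g (k + m - k)
        + (\<Sum>i\<in>{..k + m} - {k}. Polynomial.coeff f i * Polynomial.coeff g (k + m - i))"
      by (intro sum.remove) auto
    also have "Polynomial.coeff f k * Polynomial.coeff g (k + m - k) = Polynomial.coeff f k" using g(1) by (simp add: m_def)
    finally have "Polynomial.coeff f k = Polynomial.coeff (f * g) (k + m)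
        - (\<Sum>i\<in>{..k + m} - {k}. Polynomial.coeff f i * Polynomial.coeff g (k + m - i))" by simp
    moreover have "Polynomial.coeff f i * Polynomial.coeff g (k + m - i) \<in> \<int>" if "i \<in> {..k + m} - {k}" for i
    proof (cases "i > k")
      case True
      thus ?thesis by (intro Ints_mult IH g)
    next
      case False
      hence "k + m - i > degree g" using that by (auto simp: m_def)
      thus ?thesis by (simp add: coeff_eq_0)
    qed
    ultimately show ?thesis by (metis (no_types, lifting) Ints_diff Ints_sum fg)
  qed
qed

text \<open>By strong induction the product over the proper divisors of \<open>n\<close> is monic
  with integer coefficients, and \<open>cyclo n\<close> is the quotient of \<open>X^n - 1\<close> by
  it.\<close>

lemma coeff_cyclo_Ints: "Polynomial.coeff (cyclo n) i \<in> \<int>"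
proof (induction n arbitrary: i rule: less_induct)
  case (less n)
  show ?case
  proof (cases "n = 0")
    case True
    thus ?thesis by (simp add: cyclo_def coeff_1)
  next
    case False
    define g where "g = (\<Prod>j\<in>{j. j dvd n} - {n}. cyclo j)"
    have "lead_coeff g = 1" unfolding g_def
      by (induction "{j. j dvd n} - {n}" rule: infinite_finite_induct) (simp_all add: lead_coeff_prod)
    moreover have "Polynomial.coeff g i \<in> \<int>" for i unfolding g_def
      using False by (intro coeff_prod_Ints less) (auto simp: dvd_imp_le le_neq_implies_less)
    moreover have "cyclo n * g = (\<Prod>j | j dvd n. cyclo j)"
      unfolding g_def using False by (intro prod.remove[symmetric]) auto
    hence "Polynomial.coeff (cyclo n * g) i \<in> \<int>" for i
      using False by (simp add: prod_cyclo coeff_1)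
    ultimately show ?thesis by (rule coeff_quotient_monic_Ints)
  qed
qed

text \<open>The homogenised cyclotomic polynomial, that is, the norm of \<open>b - \<zeta> q\<close>.\<close>
definition cyclo_form :: "nat \<Rightarrow> int \<Rightarrow> int \<Rightarrow> complex" where
  "cyclo_form n b q = (\<Prod>i\<in>totatives n. of_int b - cis (2 * pi * real i / real n) * of_int q)"

lemma cyclo_form_eq_poly:
  assumes "q \<noteq> 0"
  shows "cyclo_form n b q = of_int q ^ totient n * poly (cyclo n) (of_int b / of_int q)"
proof -
  have "cyclo_form n b q = (\<Prod>i\<in>totatives n. of_int q *
      poly [:- cis (2 * pi * real i / real n), 1:] (of_int b / of_int q))"
    unfolding cyclo_form_def using assms by (intro prod.cong refl) (simp add: field_simps)
  thus ?thesis by (simp add: prod.distrib cyclo_def poly_prod totient_def)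
qed

text \<open>\<open>cyclo n\<close> has integer coefficients and degree \<open>totient n\<close>, so
  the factor \<open>q ^ totient n\<close> clears all denominators of its value at
  \<open>b / q\<close>.\<close>

lemma cyclo_form_Ints:
  assumes "q \<noteq> 0"
  shows "cyclo_form n b q \<in> \<int>"
proof -
  have "cyclo_form n b q = (\<Sum>i\<le>totient n. of_int q ^ totient n *
      (Polynomial.coeff (cyclo n) i * (of_int b / of_int q) ^ i))"
    by (simp add: cyclo_form_eq_poly[OF assms] poly_altdef degree_cyclo sum_distrib_left)
  also have "\<dots> = (\<Sum>i\<le>totient n. Polynomial.coeff (cyclo n) i * of_int (b ^ i * q ^ (totient n - i)))"
  proof (intro sum.cong refl)
    fix i assume "i \<in> {..totient n}"
    hence "of_int q ^ totient n = (of_int q ^ i * of_int q ^ (totient n - i) :: complex)"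
      by (simp flip: power_add)
    thus "of_int q ^ totient n * (Polynomial.coeff (cyclo n) i * (of_int b / of_int q) ^ i)
        = Polynomial.coeff (cyclo n) i * of_int (b ^ i * q ^ (totient n - i))"
      using assms by (simp add: field_simps)
  qed
  also have "\<dots> \<in> \<int>" by (intro Ints_sum Ints_mult coeff_cyclo_Ints) auto
  finally show ?thesis .
qed

text \<open>Homogenisation of the factorisation of \<open>X^n - 1\<close>; the powers of
  \<open>q\<close> combine to \<open>q ^ n\<close> because the totients of the divisors of
  \<open>n\<close> sum to \<open>n\<close>.\<close>

lemma prod_cyclo_form:
  assumes "n > 0" "q \<noteq> 0"
  shows "(\<Prod>j | j dvd n. cyclo_form j b q) = of_int (b ^ n - q ^ n)"
proof -
  have "(\<Prod>j | j dvd n. cyclo_form j b q)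
      = of_int q ^ (\<Sum>j | j dvd n. totient j) * poly (\<Prod>j | j dvd n. cyclo j) (of_int b / of_int q)"
    using assms by (simp add: cyclo_form_eq_poly prod.distrib poly_prod power_sum)
  also have "\<dots> = of_int q ^ n * ((of_int b / of_int q) ^ n - 1)"
    using assms by (simp only: totient_divisor_sum prod_cyclo) (simp add: poly_monom)
  also have "\<dots> = of_int (b ^ n - q ^ n)" using assms by (simp add: field_simps)
  finally show ?thesis .
qed

text \<open>A vanishing factor would make a primitive \<open>n\<close>-th root of unity equal to the
  real number \<open>b / q\<close>. For odd \<open>n\<close> the only real \<open>n\<close>-th root
  of unity is 1, which is not primitive when \<open>n > 1\<close>.\<close>

lemma cyclo_form_nonzero:
  assumes "odd n" "n > 1" "q \<noteq> 0"
  shows "cyclo_form n b q \<noteq> 0"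
proof
  assume "cyclo_form n b q = 0"
  then obtain i where i: "i \<in> totatives n"
    and eq: "of_int b = cis (2 * pi * real i / real n) * of_int q"
    unfolding cyclo_form_def by (auto simp: prod_zero_iff)
  define z where "z = cis (2 * pi * real i / real n)"
  have "i < n" "i \<noteq> 0" using i assms totatives_less[of i n] by (auto simp: in_totatives_iff)
  have bij: "bij_betw (\<lambda>k. cis (2 * pi * real k / real n)) {..<n} {z. z ^ n = 1}"
    using assms Complex.bij_betw_roots_unity[of n] by simp
  have "z = of_real (of_int b / of_int q)" using eq assms(3) by (simp add: z_def field_simps)
  then obtain r where r: "z = of_real r" by blast
  have zn: "z ^ n = 1" using bij \<open>i < n\<close> unfolding z_def bij_betw_def by blast
  hence "r ^ n = 1" unfolding r by (metis of_real_1 of_real_eq_iff of_real_power)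
  hence "r = 1" using assms by (metis odd_real_root_power_cancel real_root_one odd_pos)
  hence "cis (2 * pi * real i / real n) = cis (2 * pi * real 0 / real n)"
    using r by (simp add: z_def)
  hence "i = 0" using bij \<open>i < n\<close> assms unfolding bij_betw_def inj_on_def by fastforce
  thus False using \<open>i \<noteq> 0\<close> by contradiction
qed

lemma norm_cyclo_form_le: "norm (cyclo_form n b q) \<le> (\<bar>of_int b\<bar> + \<bar>of_int q\<bar>) ^ totient n"
proof -
  have "norm (cyclo_form n b q)
      = (\<Prod>i\<in>totatives n. norm (of_int b - cis (2 * pi * real i / real n) * of_int q))"
    unfolding cyclo_form_def by (rule prod_norm[symmetric])
  also have "\<dots> \<le> (\<Prod>i\<in>totatives n. \<bar>of_int b\<bar> + \<bar>of_int q\<bar>)"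
  proof (intro prod_mono conjI norm_ge_zero)
    fix i
    show "norm (of_int b - cis (2 * pi * real i / real n) * of_int q) \<le> \<bar>of_int b\<bar> + \<bar>of_int q\<bar>"
      using norm_triangle_ineq4[of "of_int b" "cis (2 * pi * real i / real n) * of_int q"]
      by (simp add: norm_mult)
  qed
  finally show ?thesis by (simp add: totient_def)
qed

text \<open>The totient is monotone along divisibility, so the maximum over the divisors is attained
  at \<open>d\<close> itself.\<close>

lemma gamma_eq_totient:
  assumes "d > 0"
  shows "gamma d = totient d"
  unfolding gamma_def using assms by (intro Max_eqI) (auto intro: totient_dvd_mono)

text \<open>The prime \<open>p\<close> divides one of the integers \<open>cyclo_form j b q\<close>
  with \<open>j dvd d\<close>. The factor for \<open>j = 1\<close> is \<open>b - q\<close>, which is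
  excluded; every other one is nonzero since \<open>j\<close> is odd, so \<open>p\<close> is at most
  its absolute value.\<close>

lemma short_vector_bound:
  fixes p b q :: int
  assumes p: "prime p" and d: "odd d" and q: "q \<noteq> 0"
    and dvd: "p dvd b ^ d - q ^ d" and ndvd: "\<not> p dvd b - q"
  shows "p \<le> (\<bar>b\<bar> + \<bar>q\<bar>) ^ gamma d"
proof -
  have d0: "d > 0" using d by (rule odd_pos)
  have "\<forall>j. \<exists>k. cyclo_form j b q = of_int k"
    using cyclo_form_Ints[OF q] by (metis Ints_cases)
  then obtain I where I: "\<And>j. cyclo_form j b q = of_int (I j)" by metis
  have "of_int (\<Prod>j | j dvd d. I j) = (of_int (b ^ d - q ^ d) :: complex)"
    using prod_cyclo_form[OF d0 q, of b] by (simp add: I)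
  hence "(\<Prod>j | j dvd d. I j) = b ^ d - q ^ d" by (simp only: of_int_eq_iff)
  with dvd have "p dvd (\<Prod>j | j dvd d. I j)" by simp
  then obtain j where j: "j dvd d" "p dvd I j"
    using p d0 by (auto simp: prime_dvd_prod_iff)
  have "j \<noteq> 1"
  proof
    assume "j = 1"
    hence "of_int (I j) = (of_int (b - q) :: complex)"
      using I[of j] by (simp add: cyclo_form_def)
    hence "I j = b - q" by (simp only: of_int_eq_iff)
    with j(2) ndvd show False by simp
  qed
  moreover have "odd j" using j(1) d by (meson dvd_trans)
  ultimately have "cyclo_form j b q \<noteq> 0" using q
    by (intro cyclo_form_nonzero) (auto elim: oddE)
  hence "I j \<noteq> 0" using I[of j] by auto
  hence "p \<le> \<bar>I j\<bar>" using j(2) dvd_imp_le_int by force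
  have "real_of_int \<bar>I j\<bar> = norm (cyclo_form j b q)" by (simp add: I)
  also have "\<dots> \<le> (\<bar>of_int b\<bar> + \<bar>of_int q\<bar>) ^ totient j" by (rule norm_cyclo_form_le)
  also have "\<dots> \<le> (\<bar>of_int b\<bar> + \<bar>of_int q\<bar>) ^ gamma d"
    using q j(1) d0 by (intro power_increasing) (auto simp: gamma_eq_totient intro: totient_dvd_mono)
  finally have "real_of_int \<bar>I j\<bar> \<le> real_of_int ((\<bar>b\<bar> + \<bar>q\<bar>) ^ gamma d)" by simp
  thus ?thesis using \<open>p \<le> \<bar>I j\<bar>\<close> by linarith
qed

subsection \<open>Dilations by roots of unity\<close>

text \<open>The block of length \<open>q\<close> starting at \<open>c\<close> is counted by
  \<open>card_block_residues\<close> with the shift \<open>x = h * c\<close>, and each block adds at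
  most 4 to the error.\<close>

lemma card_residues_initial_blocks:
  fixes h q a b p N :: int
  assumes "q > 0" "p > 0" "coprime a q" "h * q = a * p + b" "q * \<bar>b\<bar> \<le> p" "q \<le> p" "1 \<le> N" "N < p"
  shows "\<bar>real (card {n\<in>{1..int B * q}. (h * n) mod p \<in> {1..N}})
    - real B * (of_int q * of_int N / of_int p)\<bar> \<le> 4 * real B"
proof (induction B)
  case 0
  show ?case by simp
next
  case (Suc B)
  define S where "S = (\<lambda>B. {n\<in>{1..int B * q}. (h * n) mod p \<in> {1..N}})"
  define X where "X = real_of_int q * of_int N / of_int p"
  define c where "c = int B * q + 1"
  define T where "T = {j\<in>{0..<q}. (h * c + h * j) mod p \<in> {1..N}}"
  have "S (Suc B) = S B \<union> (\<lambda>j. c + j) ` T"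
  proof (intro equalityI subsetI)
    fix n assume n: "n \<in> S (Suc B)"
    show "n \<in> S B \<union> (\<lambda>j. c + j) ` T"
    proof (cases "n \<le> int B * q")
      case True
      thus ?thesis using n by (auto simp: S_def)
    next
      case False
      hence "n - c \<in> T" using n by (auto simp: S_def T_def c_def algebra_simps)
      thus ?thesis by (auto intro!: image_eqI[of _ _ "n - c"])
    qed
  next
    fix n assume "n \<in> S B \<union> (\<lambda>j. c + j) ` T"
    thus "n \<in> S (Suc B)"
      using \<open>q > 0\<close> by (auto simp: S_def T_def c_def algebra_simps)
  qed
  moreover have "finite (S B)" unfolding S_def
    by (rule finite_subset[of _ "{1..int B * q}"]) auto
  moreover have "finite T" unfolding T_def by (rule finite_subset[of _ "{0..<q}"]) auto
  moreover have "S B \<inter> (\<lambda>j. c + j) ` T = {}" by (auto simp: S_def T_def c_def)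
  ultimately have "card (S (Suc B)) = card (S B) + card T"
    by (simp add: card_Un_disjoint card_image)
  moreover have "\<bar>real (card T) - X\<bar> \<le> 4"
    unfolding T_def X_def using assms by (intro card_block_residues)
  moreover have "\<bar>real (card (S B)) - real B * X\<bar> \<le> 4 * real B"
    using Suc.IH unfolding S_def X_def .
  ultimately have "\<bar>real (card (S (Suc B))) - real (Suc B) * X\<bar> \<le> 4 * real (Suc B)"
    by (simp add: distrib_right abs_le_iff)
  thus ?case unfolding S_def X_def .
qed

text \<open>Write \<open>N = B * q + r\<close> with \<open>0 \<le> r < q\<close>. The full blocks
  cost \<open>4 * B \<le> 4 * p / q\<close>; in the incomplete one both the count and the expected
  value lie between 0 and \<open>q\<close>, and \<open>q \<le> p / q\<close> since
  \<open>q * q \<le> p\<close>.\<close>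

lemma card_dilation_error:
  fixes h q a b p N :: int
  assumes q: "q > 0" and cop: "coprime a q" and h: "h * q = a * p + b"
    and b: "\<bar>b\<bar> \<le> q" and qp: "q * q \<le> p" and N: "1 \<le> N" "N < p"
  shows "\<bar>real (card {n\<in>{1..N}. (h * n) mod p \<in> {1..N}}) - (of_int N)\<^sup>2 / of_int p\<bar>
    \<le> 5 * of_int p / of_int q"
proof -
  have p: "p > 0" using N by simp
  have "q * \<bar>b\<bar> \<le> q * q" using q b by (intro mult_left_mono) auto
  hence qb: "q * \<bar>b\<bar> \<le> p" using qp by simp
  have "q * 1 \<le> q * q" using q by (intro mult_left_mono) auto
  hence qp': "q \<le> p" using qp by simp
  define B where "B = nat (N div q)"
  define r where "r = N mod q"
  have B: "int B = N div q" unfolding B_def using N q by (simp add: pos_imp_zdiv_nonneg_iff)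
  have N_eq: "N = int B * q + r" unfolding B r_def by simp
  have r: "0 \<le> r" "r < q" unfolding r_def using q by auto
  define S where "S = {n\<in>{1..int B * q}. (h * n) mod p \<in> {1..N}}"
  define T where "T = {n\<in>{int B * q + 1..N}. (h * n) mod p \<in> {1..N}}"
  have "{n\<in>{1..N}. (h * n) mod p \<in> {1..N}} = S \<union> T"
    using N_eq r q by (auto simp: S_def T_def) (smt (verit) mult_nonneg_nonneg of_nat_0_le_iff)
  moreover have "finite S" unfolding S_def
    by (rule finite_subset[of _ "{1..int B * q}"]) auto
  moreover have "finite T" unfolding T_def by (rule finite_subset[of _ "{int B * q + 1..N}"]) auto
  moreover have "S \<inter> T = {}" by (auto simp: S_def T_def)
  ultimately have card: "card {n\<in>{1..N}. (h * n) mod p \<in> {1..N}} = card S + card T"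
    by (simp add: card_Un_disjoint)
  have "card T \<le> card {int B * q + 1..N}" unfolding T_def by (intro card_mono) auto
  hence T: "real (card T) \<le> of_int q" using r N_eq by auto
  have S: "\<bar>real (card S) - real B * (of_int q * of_int N / of_int p)\<bar> \<le> 4 * real B"
    unfolding S_def using q p cop h qb qp' N by (rule card_residues_initial_blocks)
  have rN: "real_of_int N = real B * of_int q + of_int r"
    by (metis N_eq of_int_add of_int_mult of_int_of_nat_eq)
  have "(of_int N)\<^sup>2 / of_int p = real B * (of_int q * of_int N / of_int p) + of_int r * of_int N / of_int p"
    unfolding power2_eq_square by (subst rN) (simp add: add_divide_distrib algebra_simps)
  moreover have "0 \<le> real_of_int r * of_int N / of_int p" using r N by simp
  moreover have "real_of_int r * of_int N / of_int p \<le> of_int q"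
  proof -
    have "real_of_int r * of_int N \<le> of_int q * of_int p"
      using r N by (intro mult_mono) auto
    thus ?thesis using p by (simp add: field_simps)
  qed
  ultimately have "\<bar>real (card {n\<in>{1..N}. (h * n) mod p \<in> {1..N}}) - (of_int N)\<^sup>2 / of_int p\<bar>
      \<le> 4 * real B + of_int q"
    using S T unfolding card by (simp add: abs_le_iff)
  moreover have "real B \<le> of_int p / of_int q"
  proof -
    have "real B * of_int q \<le> of_int p" using rN r N by linarith
    thus ?thesis using q by (simp add: field_simps)
  qed
  moreover have "real_of_int q \<le> of_int p / of_int q"
    using q qp by (simp add: field_simps flip: of_int_mult)
  ultimately show ?thesis by linarith
qed

text \<open>The map \<open>n \<mapsto> h * n mod p\<close> carries the first set onto the second,
  with dilation by \<open>h'\<close> as its inverse; \<open>N < p\<close> ensures that elements of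
  the interval are their own residues.\<close>

lemma card_dilation_inverse:
  fixes h h' p N :: int
  assumes "p dvd h * h' - 1" "N < p"
  shows "card {n\<in>{1..N}. (h * n) mod p \<in> {1..N}} = card {n\<in>{1..N}. (h' * n) mod p \<in> {1..N}}"
proof -
  have inv: "(g' * ((g * n) mod p)) mod p = n"
    if "p dvd g * g' - 1" "n \<in> {1..N}" for g g' n :: int
  proof -
    have "[g * g' = 1] (mod p)" using that by (simp add: cong_iff_dvd_diff)
    hence "[(g * g') * n = 1 * n] (mod p)" by (rule cong_scalar_right)
    hence "(g' * ((g * n) mod p)) mod p = n mod p"
      by (simp add: cong_def mod_mult_right_eq mult_ac)
    thus ?thesis using that assms(2) by simp
  qed
  have inv': "p dvd h' * h - 1" using assms(1) by (simp add: mult.commute)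
  show ?thesis
    by (rule bij_betw_same_card[of "\<lambda>n. (h * n) mod p"],
        rule bij_betw_byWitness[where f' = "\<lambda>n. (h' * n) mod p"])
       (use inv[OF assms(1)] inv[OF inv'] in auto)
qed

text \<open>Pigeonhole principle: with \<open>s\<close> the integer part of the square root of
  \<open>p\<close>, there are \<open>(s + 1)^2 > p\<close> pairs in
  \<open>{0..s} \<times> {0..s}\<close>, so two of them agree in \<open>h * x - y\<close> mod
  \<open>p\<close>, and their difference is the desired vector.\<close>

lemma thue_lemma:
  fixes h p :: int
  assumes p: "p > 0"
  obtains u v where "u \<noteq> 0 \<or> v \<noteq> 0" "p dvd h * u - v" "u\<^sup>2 \<le> p" "v\<^sup>2 \<le> p"
proof -
  define s where "s = int (floor_sqrt (nat p))"
  have s0: "s \<ge> 0" by (simp add: s_def)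
  have "int ((floor_sqrt (nat p))\<^sup>2) \<le> int (nat p)" by (simp only: of_nat_le_iff floor_sqrt_power2_le)
  hence s1: "s\<^sup>2 \<le> p" using p by (simp add: s_def)
  have "int (nat p) < int ((Suc (floor_sqrt (nat p)))\<^sup>2)"
    by (simp only: of_nat_less_iff Suc_floor_sqrt_power2_gt)
  hence s2: "p < (s + 1)\<^sup>2" using p by (simp add: s_def add.commute)
  define f where "f = (\<lambda>(x, y). (h * x - y) mod p)"
  define A where "A = {0..s} \<times> {0..s}"
  have "f ` A \<subseteq> {0..<p}" using p by (auto simp: f_def)
  hence "card (f ` A) \<le> card {0..<p}" by (intro card_mono) auto
  also have "\<dots> < card A"
  proof -
    have "int (card A) = (s + 1)\<^sup>2" using s0 by (simp add: A_def power2_eq_square)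
    thus ?thesis using s2 p by auto
  qed
  finally have "\<not> inj_on f A" by (rule pigeonhole)
  then obtain x y x' y' where xy: "(x, y) \<in> A" "(x', y') \<in> A" "(x, y) \<noteq> (x', y')"
    "(h * x - y) mod p = (h * x' - y') mod p"
    by (auto simp: inj_on_def f_def)
  have sq: "t\<^sup>2 \<le> p" if "\<bar>t\<bar> \<le> s" for t :: int
  proof -
    have "t\<^sup>2 \<le> s\<^sup>2" using that power_mono[of "\<bar>t\<bar>" s 2] by simp
    thus ?thesis using s1 by simp
  qed
  show ?thesis
  proof (rule that[of "x - x'" "y - y'"])
    have "p dvd (h * x - y) - (h * x' - y')" using xy(4) by (simp add: mod_eq_dvd_iff)
    thus "p dvd h * (x - x') - (y - y')" by (simp add: algebra_simps)
    show "(x - x')\<^sup>2 \<le> p" "(y - y')\<^sup>2 \<le> p" using xy by (auto intro!: sq simp: A_def)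
  qed (use xy in auto)
qed

text \<open>The block count requires \<open>a\<close> and \<open>q\<close> to be coprime, so the
  relation \<open>g * u - v = p * c\<close> is divided by \<open>e = gcd c u\<close>, which divides
  \<open>v\<close> as well. The lower bound on \<open>q\<close> holds because
  \<open>b \<equiv> g * q\<close> gives \<open>b ^ d \<equiv> q ^ d\<close> mod \<open>p\<close>,
  while \<open>g \<noteq> 1\<close> and \<open>q \<noteq> 0\<close> mod \<open>p\<close> give
  \<open>b \<noteq> q\<close> mod \<open>p\<close>.\<close>

lemma reduced_short_vector:
  fixes g p u v :: int
  assumes p: "prime p" and d: "odd d" and g: "p dvd g ^ d - 1" "\<not> p dvd g - 1"
    and u: "u > 0" "\<bar>v\<bar> \<le> u" "u\<^sup>2 \<le> p" "p dvd g * u - v"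
  obtains q a b where "q > 0" "coprime a q" "g * q = a * p + b" "\<bar>b\<bar> \<le> q" "q * q \<le> p"
    "p \<le> (2 * q) ^ gamma d"
proof -
  obtain c where c: "g * u - v = p * c" using u(4) by (elim dvdE)
  define e where "e = gcd c u"
  have e: "e > 0" using u by (simp add: e_def)
  obtain a where a: "c = e * a" unfolding e_def by (meson gcd_dvd1 dvdE)
  obtain q where q: "u = e * q" unfolding e_def by (meson gcd_dvd2 dvdE)
  define b where "b = g * q - p * a"
  have v: "v = e * b" using c unfolding a q b_def by (simp add: algebra_simps)
  have q0: "q > 0" using u(1) e unfolding q by (simp add: zero_less_mult_iff)
  have cop: "coprime a q"
  proof -
    have "gcd c u = e * gcd a q" unfolding a q using e by (simp add: gcd_mult_left abs_mult)
    hence "gcd a q = 1" using e by (simp flip: e_def)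
    thus ?thesis by (simp add: coprime_iff_gcd_eq_1)
  qed
  have bq: "\<bar>b\<bar> \<le> q" using u(2) e unfolding v q by (simp add: abs_mult)
  have "q \<le> u" unfolding q using e q0 by simp
  hence "q * q \<le> u * u" using q0 by (intro mult_mono) auto
  hence qq: "q * q \<le> p" using u(3) by (simp add: power2_eq_square)
  have p1: "p > 1" using p prime_gt_1_int by blast
  have qp: "q < p"
  proof (rule ccontr)
    assume "\<not> q < p"
    hence "p * p \<le> q * q" using p1 by (intro mult_mono) auto
    moreover have "p * 1 < p * p" using p1 by (intro mult_strict_left_mono) auto
    ultimately show False using qq by simp
  qed
  hence npq: "\<not> p dvd q" using q0 zdvd_not_zless by blast
  have cong: "[b = g * q] (mod p)" by (simp add: b_def cong_iff_dvd_diff)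
  have "[b ^ d = (g * q) ^ d] (mod p)" using cong by (rule cong_pow)
  also have "(g * q) ^ d = g ^ d * q ^ d" by (simp add: power_mult_distrib)
  also have "[g ^ d * q ^ d = 1 * q ^ d] (mod p)"
    using g(1) by (intro cong_scalar_right) (simp add: cong_iff_dvd_diff)
  finally have 1: "p dvd b ^ d - q ^ d" by (simp add: cong_iff_dvd_diff)
  have 2: "\<not> p dvd b - q"
  proof
    assume "p dvd b - q"
    moreover have "(g - 1) * q = (b - q) + p * a" by (simp add: b_def algebra_simps)
    ultimately have "p dvd (g - 1) * q" by simp
    thus False using npq g(2) p by (simp add: prime_dvd_mult_iff)
  qed
  have "p \<le> (\<bar>b\<bar> + \<bar>q\<bar>) ^ gamma d" using p d q0 1 2 by (intro short_vector_bound) auto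
  also have "\<dots> \<le> (2 * q) ^ gamma d" using bq q0 by (intro power_mono) auto
  finally show ?thesis
    using that[of q a b] q0 cop bq qq by (simp add: b_def algebra_simps)
qed

lemma card_dilation_error_root_of_unity:
  fixes h p N :: int
  assumes p: "prime p" and d: "odd d" and h: "p dvd h ^ d - 1" "\<not> p dvd h - 1"
    and N: "1 \<le> N" "N < p"
  shows "\<bar>real (card {n\<in>{1..N}. (h * n) mod p \<in> {1..N}}) - (of_int N)\<^sup>2 / of_int p\<bar>
    \<le> 10 * of_int p powr (1 - 1 / real (gamma d))"
proof -
  define F where "F = (\<lambda>h. card {n\<in>{1..N}. (h * n) mod p \<in> {1..N}})"
  have p1: "p > 1" using p prime_gt_1_int by blast
  have d0: "d > 0" using d by (rule odd_pos)
  have gpos: "gamma d > 0"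
    using d0 by (simp add: gamma_eq_totient)
  \<comment> \<open>Extracting roots in \<open>p \<le> (2 * q) ^ gamma d\<close> turns the error
    \<open>5 * p / q\<close> into the claimed one and doubles the constant. The multiplier
    \<open>g\<close> is left general so that both \<open>h\<close> and its inverse can be
    inserted.\<close>
  have bound: "\<bar>real (F g) - (of_int N)\<^sup>2 / of_int p\<bar> \<le> 10 * of_int p powr (1 - 1 / real (gamma d))"
    if g: "p dvd g ^ d - 1" "\<not> p dvd g - 1"
    and uv: "u > 0" "\<bar>v\<bar> \<le> u" "u\<^sup>2 \<le> p" "p dvd g * u - v" for g u v
  proof -
    obtain q a b where q: "q > 0" "coprime a q" "g * q = a * p + b" "\<bar>b\<bar> \<le> q" "q * q \<le> p"
      and le: "p \<le> (2 * q) ^ gamma d"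
      using reduced_short_vector[OF p d g uv] by metis
    have "real_of_int p \<le> of_int ((2 * q) ^ gamma d)" using le by (simp only: of_int_le_iff)
    hence "real_of_int p \<le> (2 * of_int q) powr real (gamma d)"
      using q(1) by (simp add: powr_realpow)
    hence "real_of_int p powr (1 / real (gamma d))
        \<le> ((2 * of_int q) powr real (gamma d)) powr (1 / real (gamma d))"
      using p1 by (intro powr_mono2) auto
    also have "\<dots> = 2 * of_int q" using q(1) gpos by (simp add: powr_powr)
    finally have le': "real_of_int p powr (1 / real (gamma d)) \<le> 2 * of_int q" .
    have "\<bar>real (F g) - (of_int N)\<^sup>2 / of_int p\<bar> \<le> 5 * of_int p / of_int q"
      unfolding F_def using q N by (intro card_dilation_error)
    also have "\<dots> \<le> 10 * (of_int p / of_int p powr (1 / real (gamma d)))"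
    proof -
      have "real_of_int p powr (1 / real (gamma d)) > 0" using p1 by simp
      moreover have "of_int p * of_int p powr (1 / real (gamma d)) \<le> real_of_int p * (2 * of_int q)"
        using le' p1 by (intro mult_left_mono) auto
      ultimately show ?thesis using q(1) by (simp add: field_simps)
    qed
    also have "of_int p / of_int p powr (1 / real (gamma d)) = real_of_int p powr (1 - 1 / real (gamma d))"
      using p1 by (simp add: powr_diff)
    finally show ?thesis .
  qed
  have nph: "\<not> p dvd h"
  proof
    assume "p dvd h"
    hence "p dvd h ^ d" using d0 by (meson dvd_power dvd_trans)
    hence "p dvd h ^ d - (h ^ d - 1)" using h(1) by (rule dvd_diff)
    thus False using p1 by simp
  qed
  obtain u v where uv: "u \<noteq> 0 \<or> v \<noteq> 0" "p dvd h * u - v" "u\<^sup>2 \<le> p" "v\<^sup>2 \<le> p"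
    using thue_lemma[of p h] p1 by auto
  \<comment> \<open>A nonzero multiple of \<open>p\<close> has square at least
    \<open>p * p > p\<close>. Hence \<open>u = 0\<close> would force \<open>v = 0\<close>, against
    the choice of a nonzero vector.\<close>
  have small: "t = 0" if "t\<^sup>2 \<le> p" "p dvd t" for t :: int
  proof (rule ccontr)
    assume "t \<noteq> 0"
    hence "p \<le> \<bar>t\<bar>" using dvd_imp_le_int[of t p] that(2) p1 by simp
    hence "p * p \<le> \<bar>t\<bar> * \<bar>t\<bar>" using p1 by (intro mult_mono) auto
    moreover have "p * 1 < p * p" using p1 by (intro mult_strict_left_mono) auto
    ultimately show False using that(1) by (simp add: power2_eq_square)
  qed
  have "u \<noteq> 0"
  proof
    assume "u = 0"
    hence "v = 0" using uv small[of v] by simp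
    thus False using uv(1) \<open>u = 0\<close> by simp
  qed
  define u1 v1 where "u1 = \<bar>u\<bar>" and "v1 = sgn u * v"
  have u1: "u1 > 0" "u1\<^sup>2 \<le> p" "v1\<^sup>2 \<le> p" "p dvd h * u1 - v1"
  proof -
    show "u1 > 0" using \<open>u \<noteq> 0\<close> by (simp add: u1_def)
    show "u1\<^sup>2 \<le> p" "v1\<^sup>2 \<le> p" using uv \<open>u \<noteq> 0\<close> by (auto simp: u1_def v1_def sgn_if)
    have "h * u1 - v1 = sgn u * (h * u - v)"
      by (simp add: u1_def v1_def algebra_simps abs_sgn)
    thus "p dvd h * u1 - v1" using uv(2) by simp
  qed
  show ?thesis
  proof (cases "\<bar>v1\<bar> \<le> u1")
    case True
    thus ?thesis using bound[OF h, of u1 v1] u1 unfolding F_def by blast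
  next
    case False
    \<comment> \<open>The count is symmetric in the two coordinates, so pass to the inverse of \<open>h\<close>, for which
      the short vector is transposed.\<close>
    obtain h' where h': "[h * h' = 1] (mod p)"
      using nph p cong_solve_coprime_int[of h p] by (metis coprime_commute prime_imp_coprime)
    have hh': "p dvd h * h' - 1" using h' by (simp add: cong_iff_dvd_diff)
    have "[h' ^ d = 1] (mod p)"
    proof -
      have "[h' ^ d = 1 * h' ^ d] (mod p)" by simp
      also have "[1 * h' ^ d = h ^ d * h' ^ d] (mod p)"
        by (rule cong_scalar_right, rule cong_sym) (use h(1) in \<open>simp add: cong_iff_dvd_diff\<close>)
      also have "h ^ d * h' ^ d = (h * h') ^ d" by (simp add: power_mult_distrib)
      also have "[(h * h') ^ d = 1 ^ d] (mod p)" using h' by (rule cong_pow)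
      finally show ?thesis by simp
    qed
    hence h'd: "p dvd h' ^ d - 1" by (simp add: cong_iff_dvd_diff)
    have h'1: "\<not> p dvd h' - 1"
    proof
      assume "p dvd h' - 1"
      hence "[h * h' = h * 1] (mod p)" by (intro cong_scalar_left) (simp add: cong_iff_dvd_diff)
      hence "[h = 1] (mod p)" using h' by (metis cong_sym cong_trans mult.right_neutral)
      thus False using h(2) by (simp add: cong_iff_dvd_diff)
    qed
    define u2 v2 where "u2 = \<bar>v1\<bar>" and "v2 = sgn v1 * u1"
    have "p dvd h' * (h * u1 - v1)" using u1(4) by simp
    moreover have "p dvd (h * h' - 1) * u1" using hh' by simp
    ultimately have "p dvd (h * h' - 1) * u1 - h' * (h * u1 - v1)" by (rule dvd_diff[rotated])
    hence "p dvd h' * v1 - u1" by (simp add: algebra_simps)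
    moreover have "h' * u2 - v2 = sgn v1 * (h' * v1 - u1)"
      by (simp add: u2_def v2_def algebra_simps abs_sgn)
    ultimately have "p dvd h' * u2 - v2" by simp
    moreover have "u2 > 0" "\<bar>v2\<bar> \<le> u2" "u2\<^sup>2 \<le> p"
      using False u1 by (auto simp: u2_def v2_def abs_mult sgn_if)
    ultimately have "\<bar>real (F h') - (of_int N)\<^sup>2 / of_int p\<bar> \<le> 10 * of_int p powr (1 - 1 / real (gamma d))"
      using bound[OF h'd h'1, of u2 v2] by blast
    moreover have "F h = F h'" unfolding F_def by (rule card_dilation_inverse[OF hh' N(2)])
    ultimately show ?thesis unfolding F_def by simp
  qed
qed

subsection \<open>The kernel of a character\<close>

lemma dirichlet_char_mod:
  assumes "dirichlet_char p chi"
  shows "chi (a mod p) = chi a"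
proof -
  have "chi (b + k * p) = chi b" for b k
  proof (induction k)
    case (Suc k)
    have "chi (b + Suc k * p) = chi ((b + k * p) + p)" by (simp add: algebra_simps)
    also have "\<dots> = chi (b + k * p)" using assms unfolding dirichlet_char_def by blast
    finally show ?case using Suc by simp
  qed simp
  from this[of "a mod p" "a div p"] show ?thesis by simp
qed

lemma dirichlet_char_power:
  assumes "dirichlet_char p chi"
  shows "chi (a ^ k) = chi a ^ k"
  using assms unfolding dirichlet_char_def by (induction k) auto

text \<open>For a primitive root \<open>g\<close> the value \<open>chi g\<close> has exact order
  \<open>m = (p - 1) div d\<close>, so the kernel consists of the \<open>d\<close> powers
  \<open>g ^ (m * j)\<close> with \<open>j < d\<close>. Their \<open>d\<close>-th powers are powers
  of \<open>g ^ (p - 1)\<close>, which is 1 mod \<open>p\<close>.\<close>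

lemma dirichlet_char_kernel:
  assumes p: "prime p" and chi: "dirichlet_char p chi" and d: "d dvd p - 1"
    and ord: "char_order p chi = (p - 1) div d"
  shows "card {h\<in>{1..<p}. chi h = 1} = d"
    and "\<And>h. h \<in> {1..<p} \<Longrightarrow> chi h = 1 \<Longrightarrow> [h ^ d = 1] (mod p)"
proof -
  define m where "m = (p - 1) div d"
  have p1: "p > 1" using p prime_gt_1_nat by blast
  have md: "m * d = p - 1" using d by (simp add: m_def)
  hence m0: "m > 0" and d0: "d > 0" using p1 by (auto intro!: gr0I)
  obtain g where g: "residue_primroot p g" using prime_primitive_root_exists[OF p1 p] by blast
  have tot: "totatives p = {1..<p}" unfolding totatives_prime[OF p] by auto
  have bij: "bij_betw (\<lambda>i. g ^ i mod p) {..<p - 1} {1..<p}"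
    using residue_primroot_is_generator[OF p1 g] unfolding totient_prime[OF p] tot .
  have copg: "coprime g p" using g unfolding residue_primroot_def by (simp add: coprime_commute)
  have chi_g: "chi (g ^ i mod p) = chi g ^ i" for i
    by (simp add: dirichlet_char_mod[OF chi] dirichlet_char_power[OF chi])
  have fermat: "[n ^ (p - 1) = 1] (mod p)" if "coprime n p" for n
    using that p euler_theorem[of n p] by (simp add: totient_prime)
  define P where "P = (\<lambda>k. k > 0 \<and> (\<forall>n. coprime n p \<longrightarrow> chi n ^ k = 1))"
  \<comment> \<open>Some exponent satisfies \<open>P\<close>, so the \<open>LEAST\<close> in the
    definition of the order is attained and \<open>m\<close> itself satisfies
    \<open>P\<close>.\<close>
  have "P (p - 1)" unfolding P_def
  proof (intro conjI allI impI)
    fix n assume "coprime n p"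
    hence "n ^ (p - 1) mod p = 1" using fermat[of n] p1 by (simp add: cong_def)
    hence "chi n ^ (p - 1) = chi 1"
      by (metis dirichlet_char_mod[OF chi] dirichlet_char_power[OF chi])
    thus "chi n ^ (p - 1) = 1" using chi unfolding dirichlet_char_def by simp
  qed (use p1 in simp)
  hence "P m" using LeastI[of P "p - 1"] ord unfolding char_order_def P_def m_def by simp
  hence gm: "chi g ^ m = 1" using copg by (simp add: P_def)
  \<comment> \<open>Every residue prime to \<open>p\<close> is a power of \<open>g\<close>, so
    \<open>chi g ^ k = 1\<close> would make \<open>k\<close> a common exponent for all values of
    \<open>chi\<close>, contradicting the minimality of \<open>m\<close>.\<close>
  have gk: "chi g ^ k \<noteq> 1" if k: "0 < k" "k < m" for k
  proof
    assume eq: "chi g ^ k = 1"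
    have "P k" unfolding P_def
    proof (intro conjI allI impI)
      fix n assume "coprime n p"
      hence "\<not> p dvd n" using coprime_common_divisor[of n p p] p1 by auto
      hence "n mod p \<in> {1..<p}" using p1 by (simp add: dvd_eq_mod_eq_0 Suc_le_eq)
      hence "n mod p \<in> (\<lambda>i. g ^ i mod p) ` {..<p - 1}" using bij unfolding bij_betw_def by simp
      then obtain i where "n mod p = g ^ i mod p" by blast
      hence "chi n = chi g ^ i" using chi_g dirichlet_char_mod[OF chi] by metis
      hence "chi n ^ k = (chi g ^ k) ^ i" by (simp add: mult.commute flip: power_mult)
      thus "chi n ^ k = 1" using eq by simp
    qed (use k in simp)
    hence "(LEAST k. P k) \<le> k" by (rule Least_le)
    thus False using ord k unfolding char_order_def P_def m_def by simp
  qed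
  have ker: "chi g ^ i = 1 \<longleftrightarrow> m dvd i" for i
  proof -
    have "chi g ^ i = chi g ^ (m * (i div m) + i mod m)" by simp
    also have "\<dots> = (chi g ^ m) ^ (i div m) * chi g ^ (i mod m)" by (simp only: power_add power_mult)
    also have "\<dots> = chi g ^ (i mod m)" by (simp add: gm)
    finally show ?thesis using gk[of "i mod m"] m0 by (auto simp: dvd_eq_mod_eq_0)
  qed
  have H: "{h\<in>{1..<p}. chi h = 1} = (\<lambda>i. g ^ i mod p) ` (\<lambda>j. m * j) ` {..<d}"
  proof (intro equalityI subsetI)
    fix h assume h: "h \<in> {h\<in>{1..<p}. chi h = 1}"
    hence "h \<in> (\<lambda>i. g ^ i mod p) ` {..<p - 1}" using bij unfolding bij_betw_def by simp
    then obtain i where i: "i < p - 1" "h = g ^ i mod p" by blast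
    hence "m dvd i" using h ker chi_g by auto
    then obtain j where "i = m * j" by (elim dvdE)
    moreover have "m * j < m * d" using i(1) \<open>i = m * j\<close> unfolding md by simp
    hence "j < d" by simp
    ultimately show "h \<in> (\<lambda>i. g ^ i mod p) ` (\<lambda>j. m * j) ` {..<d}" using i(2) by auto
  next
    fix h assume "h \<in> (\<lambda>i. g ^ i mod p) ` (\<lambda>j. m * j) ` {..<d}"
    then obtain j where j: "j < d" "h = g ^ (m * j) mod p" by auto
    have "m * j < p - 1" using j m0 unfolding md[symmetric] by simp
    hence "h \<in> {1..<p}" using bij j unfolding bij_betw_def by auto
    moreover have "chi h = 1" unfolding j using chi_g ker by simp
    ultimately show "h \<in> {h\<in>{1..<p}. chi h = 1}" by simp
  qed
  have "inj_on (\<lambda>i. g ^ i mod p) ((\<lambda>j. m * j) ` {..<d})"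
  proof (rule inj_on_subset)
    show "inj_on (\<lambda>i. g ^ i mod p) {..<p - 1}" using bij by (rule bij_betw_imp_inj_on)
    show "(\<lambda>j. m * j) ` {..<d} \<subseteq> {..<p - 1}" using m0 unfolding md[symmetric] by auto
  qed
  moreover have "inj_on (\<lambda>j. m * j) {..<d}" using m0 by (auto simp: inj_on_def)
  ultimately show "card {h\<in>{1..<p}. chi h = 1} = d" unfolding H by (simp add: card_image)
  fix h assume "h \<in> {1..<p}" "chi h = 1"
  hence "h \<in> (\<lambda>i. g ^ i mod p) ` (\<lambda>j. m * j) ` {..<d}" using H by auto
  then obtain j where j: "h = g ^ (m * j) mod p" by auto
  have "[h ^ d = (g ^ (m * j)) ^ d] (mod p)" unfolding j by (intro cong_pow) (simp add: cong_def)
  also have "(g ^ (m * j)) ^ d = (g ^ (p - 1)) ^ j"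
    unfolding md[symmetric] power_mult[symmetric] by (simp add: ac_simps)
  also have "[(g ^ (p - 1)) ^ j = 1 ^ j] (mod p)" by (intro cong_pow fermat copg)
  finally show "[h ^ d = 1] (mod p)" by simp
qed

text \<open>A pair is determined by \<open>n1\<close> and the ratio \<open>h = n2 / n1\<close> mod
  \<open>p\<close>. Since \<open>N < p\<close>, all values of \<open>chi\<close> involved are
  nonzero, so \<open>chi n1 = chi n2\<close> means exactly that \<open>h\<close> lies in the
  kernel.\<close>

lemma card_equal_char_pairs:
  assumes p: "prime p" and chi: "dirichlet_char p chi" and N: "N < p"
  shows "card {(n1, n2). n1 \<in> {1..N} \<and> n2 \<in> {1..N} \<and> chi n1 = chi n2}
    = (\<Sum>h | h \<in> {1..<p} \<and> chi h = 1. card {n\<in>{1..N}. (h * n) mod p \<in> {1..N}})"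
proof -
  define H where "H = {h. h \<in> {1..<p} \<and> chi h = 1}"
  define T where "T = (\<lambda>h. {n\<in>{1..N}. (h * n) mod p \<in> {1..N}})"
  have mult: "chi (a * b) = chi a * chi b" and zero: "chi a = 0 \<longleftrightarrow> p dvd a" for a b
    using chi unfolding dirichlet_char_def by blast+
  have cop: "coprime n p" if "n \<in> {1..N}" for n
  proof -
    have "\<not> p dvd n" using that N by (auto dest: dvd_imp_le)
    thus ?thesis using prime_imp_coprime[OF p] by (simp add: coprime_commute)
  qed
  have "bij_betw (\<lambda>(h, n). (n, (h * n) mod p)) (SIGMA h:H. T h)
      {(n1, n2). n1 \<in> {1..N} \<and> n2 \<in> {1..N} \<and> chi n1 = chi n2}"
    unfolding bij_betw_def
  proof (intro conjI equalityI subsetI)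
    show "inj_on (\<lambda>(h, n). (n, (h * n) mod p)) (SIGMA h:H. T h)"
    proof (rule inj_onI, clarify)
      fix h n h'
      assume "h \<in> H" "h' \<in> H" "n \<in> T h" and eq: "h * n mod p = h' * n mod p"
      have "[h = h'] (mod p)"
        using eq cop[of n] \<open>n \<in> T h\<close> by (simp add: T_def cong_mult_rcancel_nat flip: cong_def)
      thus "h = h' \<and> n = n"
        using \<open>h \<in> H\<close> \<open>h' \<in> H\<close> by (simp add: H_def cong_less_modulus_unique_nat)
    qed
  next
    fix x assume "x \<in> (\<lambda>(h, n). (n, (h * n) mod p)) ` (SIGMA h:H. T h)"
    thus "x \<in> {(n1, n2). n1 \<in> {1..N} \<and> n2 \<in> {1..N} \<and> chi n1 = chi n2}"
      by (auto simp: H_def T_def dirichlet_char_mod[OF chi] mult)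
  next
    fix x assume "x \<in> {(n1, n2). n1 \<in> {1..N} \<and> n2 \<in> {1..N} \<and> chi n1 = chi n2}"
    then obtain n1 n2 where x: "x = (n1, n2)" and n: "n1 \<in> {1..N}" "n2 \<in> {1..N}" "chi n1 = chi n2"
      by auto
    obtain y where y: "[n1 * y = 1] (mod p)" using cong_solve_coprime_nat[OF cop[OF n(1)]] by auto
    define h where "h = (n2 * y) mod p"
    have "[h * n1 = n2 * (n1 * y)] (mod p)"
      unfolding h_def cong_def mod_mult_left_eq by (simp add: ac_simps)
    also have "[n2 * (n1 * y) = n2 * 1] (mod p)" using y by (rule cong_scalar_left)
    finally have hn: "(h * n1) mod p = n2" using n N by (simp add: cong_def)
    have "chi h * chi n1 = chi n1" using hn n(3) dirichlet_char_mod[OF chi, of "h * n1"] mult by simp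
    moreover have "\<not> p dvd n1" using n(1) N by (auto dest: dvd_imp_le)
    ultimately have "chi h = 1" using zero by simp
    moreover have "h \<noteq> 0" using hn n by (auto intro: gr0I)
    moreover have "h < p" using N by (simp add: h_def)
    ultimately have "(h, n1) \<in> (SIGMA h:H. T h)" using hn n by (simp add: H_def T_def)
    thus "x \<in> (\<lambda>(h, n). (n, (h * n) mod p)) ` (SIGMA h:H. T h)"
      unfolding x by (intro image_eqI[of _ _ "(h, n1)"]) (simp_all add: hn)
  qed
  hence "card {(n1, n2). n1 \<in> {1..N} \<and> n2 \<in> {1..N} \<and> chi n1 = chi n2} = card (SIGMA h:H. T h)"
    by (rule bij_betw_same_card[symmetric])
  also have "\<dots> = (\<Sum>h\<in>H. card (T h))"
    by (intro card_SigmaI) (auto simp: H_def T_def)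
  finally show ?thesis unfolding H_def T_def .
qed

text \<open>Characters are functions on the naturals, whereas the lattice argument uses signed
  integers; this transfers the counts between the two.\<close>

lemma card_dilation_int:
  "card {n\<in>{1..N}. (h * n) mod p \<in> {1..N}} =
   card {n\<in>{1..int N}. (int h * n) mod int p \<in> {1..int N}}"
proof (rule bij_betw_same_card[of int], rule bij_betw_byWitness[where f' = nat])
  show "int ` {n\<in>{1..N}. (h * n) mod p \<in> {1..N}}
      \<subseteq> {n\<in>{1..int N}. (int h * n) mod int p \<in> {1..int N}}"
    by (auto simp flip: of_nat_mult of_nat_mod)
  show "nat ` {n\<in>{1..int N}. (int h * n) mod int p \<in> {1..int N}}
      \<subseteq> {n\<in>{1..N}. (h * n) mod p \<in> {1..N}}"
  proof safe
    fix n assume n: "n \<in> {1..int N}" "(int h * n) mod int p \<in> {1..int N}"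
    then obtain k where k: "n = int k" using nonneg_int_cases[of n] by auto
    show "nat n \<in> {1..N}" "h * nat n mod p \<in> {1..N}"
      using n unfolding k by (simp_all flip: of_nat_mult of_nat_mod)
  qed
qed auto

subsection \<open>The average number of coincidences\<close>

lemma sum_real_upto: "(\<Sum>N = 1..n. real N) = real n * (real n + 1) / 2"
  by (induction n) (simp_all add: field_simps)

lemma sum_real_squares_upto: "(\<Sum>N = 1..n. (real N)\<^sup>2) = real n * (real n + 1) * (2 * real n + 1) / 6"
  by (induction n) (simp_all add: field_simps power2_eq_square)

text \<open>The kernel element 1 contributes exactly \<open>N\<close>; each of the other
  \<open>d - 1\<close> elements is a nontrivial \<open>d\<close>-th root of unity mod
  \<open>p\<close> and contributes \<open>N^2 / p\<close> up to the dilation error.\<close>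

lemma card_pairs_error:
  assumes p: "prime p" and d: "odd d" and dvd: "d dvd p - 1" and chi: "dirichlet_char p chi"
    and ord: "char_order p chi = (p - 1) div d" and N: "1 \<le> N" "N < p"
  shows "\<bar>real (card {(n1, n2). n1 \<in> {1..N} \<and> n2 \<in> {1..N} \<and> chi n1 = chi n2})
      - (real N + (real d - 1) * (real N)\<^sup>2 / real p)\<bar>
    \<le> (real d - 1) * (10 * real p powr (1 - 1 / real (gamma d)))"
proof -
  have p1: "p > 1" using p prime_gt_1_nat by blast
  define H where "H = {h \<in> {1..<p}. chi h = 1}"
  define F where "F = (\<lambda>h. card {n\<in>{1..N}. (h * n) mod p \<in> {1..N}})"
  define E where "E = 10 * real p powr (1 - 1 / real (gamma d))"
  have finH: "finite H" by (simp add: H_def)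
  have H1: "1 \<in> H" using p1 chi by (simp add: H_def dirichlet_char_def)
  have cardH: "card H = d" unfolding H_def using dirichlet_char_kernel(1)[OF p chi dvd ord] .
  have F1: "F 1 = N"
  proof -
    have "{n\<in>{1..N}. (1 * n) mod p \<in> {1..N}} = {1..N}" using N by auto
    thus ?thesis unfolding F_def by simp
  qed
  have cardH': "real (card (H - {1})) = real d - 1"
    using H1 finH cardH d by (simp add: of_nat_diff odd_pos Suc_leI)
  have err: "\<bar>real (F h) - (real N)\<^sup>2 / real p\<bar> \<le> E" if h: "h \<in> H - {1}" for h
  proof -
    have "[int h ^ d = 1] (mod int p)"
      using dirichlet_char_kernel(2)[OF p chi dvd ord, of h] h
      by (simp add: H_def flip: cong_int_iff)
    hence 1: "int p dvd int h ^ d - 1" by (simp add: cong_iff_dvd_diff)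
    have 2: "\<not> int p dvd int h - 1"
    proof
      assume "int p dvd int h - 1"
      moreover have "0 < int h - 1" "int h - 1 < int p" using h by (auto simp: H_def)
      ultimately show False using zdvd_not_zless by blast
    qed
    have "\<bar>real (card {n\<in>{1..int N}. (int h * n) mod int p \<in> {1..int N}}) - (of_int (int N))\<^sup>2 / of_int (int p)\<bar>
      \<le> 10 * of_int (int p) powr (1 - 1 / real (gamma d))"
      using p d 1 2 N by (intro card_dilation_error_root_of_unity) auto
    thus ?thesis by (simp only: F_def E_def card_dilation_int of_int_of_nat_eq)
  qed
  have "card {(n1, n2). n1 \<in> {1..N} \<and> n2 \<in> {1..N} \<and> chi n1 = chi n2} = (\<Sum>h\<in>H. F h)"
    unfolding F_def H_def by (rule card_equal_char_pairs[OF p chi N(2)])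
  also have "\<dots> = N + (\<Sum>h\<in>H - {1}. F h)" using finH H1 F1 by (simp add: sum.remove)
  finally have "real (card {(n1, n2). n1 \<in> {1..N} \<and> n2 \<in> {1..N} \<and> chi n1 = chi n2})
      - (real N + (real d - 1) * (real N)\<^sup>2 / real p)
      = (\<Sum>h\<in>H - {1}. real (F h) - (real N)\<^sup>2 / real p)"
    using cardH' by (simp add: sum_subtractf)
  also have "\<bar>\<dots>\<bar> \<le> (\<Sum>h\<in>H - {1}. E)"
    by (intro order_trans[OF sum_abs] sum_mono err)
  also have "\<dots> = (real d - 1) * E" using cardH' by simp
  finally show ?thesis unfolding E_def .
qed

text \<open>Averaging the main terms over \<open>N\<close> gives
  \<open>p / 2 + (d - 1) * (2 * p - 1) / 6\<close>, which differs from
  \<open>(2 * d + 1) / 6 * p\<close> by exactly \<open>(d - 1) / 6\<close>. This difference raises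
  the constant from 10 to 11.\<close>

lemma cA_error:
  assumes p: "prime p" and d: "odd d" and dvd: "d dvd p - 1" and chi: "dirichlet_char p chi"
    and ord: "char_order p chi = (p - 1) div d"
  shows "\<bar>cA p chi - (2 * real d + 1) / 6 * real p\<bar>
    \<le> 11 * real d * real p powr (1 - 1 / real (gamma d))"
proof -
  have p1: "p > 1" using p prime_gt_1_nat by blast
  have d0: "d > 0" using d by (rule odd_pos)
  define X where "X = real p powr (1 - 1 / real (gamma d))"
  define G where "G = (\<lambda>N. real (card {(n1, n2). n1 \<in> {1..N} \<and> n2 \<in> {1..N} \<and> chi n1 = chi n2}))"
  define M where "M = (\<lambda>N. real N + (real d - 1) * (real N)\<^sup>2 / real p)"
  define R where "R = (\<Sum>N = 1..p - 1. G N - M N)"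
  have rp: "real (p - 1) = real p - 1" using p1 by (simp add: of_nat_diff)
  \<comment> \<open>The exponent in \<open>X\<close> is thus nonnegative, and
    \<open>X \<ge> 1\<close> lets the error term absorb \<open>(d - 1) / 6\<close>.\<close>
  have "gamma d \<ge> 1" using d0 by (simp add: gamma_eq_totient Suc_le_eq)
  hence X1: "X \<ge> 1" unfolding X_def using p1 by (intro ge_one_powr_ge_zero) auto
  have "\<bar>R\<bar> \<le> (\<Sum>N = 1..p - 1. (real d - 1) * (10 * X))"
    unfolding R_def G_def M_def X_def
    by (intro order_trans[OF sum_abs] sum_mono card_pairs_error[OF p d dvd chi ord]) (use p1 in auto)
  also have "\<dots> = (real p - 1) * ((real d - 1) * (10 * X))" using rp by simp
  finally have R: "\<bar>R / (real p - 1)\<bar> \<le> (real d - 1) * (10 * X)"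
    using p1 by (simp add: abs_divide divide_le_eq mult.commute)
  have "(\<Sum>N = 1..p - 1. M N) = (\<Sum>N = 1..p - 1. real N) + (real d - 1) / real p * (\<Sum>N = 1..p - 1. (real N)\<^sup>2)"
    unfolding M_def by (simp add: sum.distrib sum_distrib_left)
  also have "\<dots> = (real p - 1) * (real p / 2 + (real d - 1) * (2 * real p - 1) / 6)"
    unfolding sum_real_upto sum_real_squares_upto rp using p1 by (simp add: field_simps)
  finally have M: "(\<Sum>N = 1..p - 1. M N) = \<dots>" .
  have "cA p chi = (\<Sum>N = 1..p - 1. G N) / (real p - 1)"
    unfolding cA_def G_def rp by simp
  also have "(\<Sum>N = 1..p - 1. G N) = (\<Sum>N = 1..p - 1. M N) + R"
    unfolding R_def by (simp add: sum_subtractf)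
  also have "\<dots> / (real p - 1) = real p / 2 + (real d - 1) * (2 * real p - 1) / 6 + R / (real p - 1)"
    unfolding M using p1 by (simp add: add_divide_distrib)
  finally have "cA p chi = \<dots>" .
  moreover have "real p / 2 + (real d - 1) * (2 * real p - 1) / 6 - (2 * real d + 1) / 6 * real p
      = - ((real d - 1) / 6)"
    by (simp add: field_simps)
  ultimately have "cA p chi - (2 * real d + 1) / 6 * real p = R / (real p - 1) - (real d - 1) / 6"
    by linarith
  also have "\<bar>\<dots>\<bar> \<le> \<bar>R / (real p - 1)\<bar> + \<bar>(real d - 1) / 6\<bar>"
    by (rule abs_triangle_ineq4)
  also have "\<bar>(real d - 1) / 6\<bar> \<le> (real d - 1) * 1" using d0 by simp
  also have "\<bar>R / (real p - 1)\<bar> + (real d - 1) * 1 \<le> (real d - 1) * (10 * X) + (real d - 1) * X"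
    using X1 d0 by (intro add_mono R mult_left_mono) auto
  also have "\<dots> = (real d - 1) * (11 * X)" by (simp add: algebra_simps)
  also have "\<dots> \<le> real d * (11 * X)" using X1 by (intro mult_right_mono) auto
  finally show ?thesis unfolding X_def by (simp add: algebra_simps)
qed

text \<open>With \<open>L = ln p\<close>, the bound
  \<open>gamma d \<le> d \<le> L / (2 * ln L)\<close> gives
  \<open>p powr (- 1 / gamma d) = exp (- L / gamma d) \<le> 1 / L^2\<close>. The constant is
  \<open>11 * 3\<close>, since \<open>d * p\<close> is at most three times the main term.\<close>

lemma cA_relative_error:
  assumes p: "prime p" and d: "odd d" and dvd: "d dvd p - 1" and chi: "dirichlet_char p chi"
    and ord: "char_order p chi = (p - 1) div d"
    and ln: "ln (real p) > 1" and le: "real d \<le> ln (real p) / (2 * ln (ln (real p)))"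
  shows "\<bar>cA p chi / ((2 * real d + 1) / 6 * real p) - 1\<bar> \<le> 33 / (ln (real p))\<^sup>2"
proof -
  have p1: "p > 1" using p prime_gt_1_nat by blast
  have d0: "d > 0" using d by (rule odd_pos)
  define \<gamma> where "\<gamma> = real (gamma d)"
  define M where "M = (2 * real d + 1) / 6 * real p"
  have "3 * M = real d * real p + real p / 2" by (simp add: M_def field_simps)
  hence M: "M > 0" "real d * real p \<le> 3 * M" using p1 d0 by (auto simp: M_def)
  have \<gamma>: "0 < \<gamma>" "\<gamma> \<le> real d" using d0 totient_le[of d] by (simp_all add: \<gamma>_def gamma_eq_totient)
  have lnln: "ln (ln (real p)) > 0" using ln by simp
  have "\<gamma> * (2 * ln (ln (real p))) \<le> ln (real p)"
    using le \<gamma> lnln by (simp add: field_simps) (smt (verit) mult_right_mono)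
  hence "2 * ln (ln (real p)) \<le> ln (real p) / \<gamma>" using \<gamma> by (simp add: field_simps)
  hence "real p powr (- 1 / \<gamma>) \<le> exp (- (2 * ln (ln (real p))))"
    using p1 by (simp add: powr_def)
  also have "\<dots> = 1 / (ln (real p))\<^sup>2"
    using ln by (simp add: exp_minus exp_double field_simps)
  finally have small: "real p powr (- 1 / \<gamma>) \<le> 1 / (ln (real p))\<^sup>2" .
  have "\<bar>cA p chi - M\<bar> \<le> 11 * real d * real p powr (1 - 1 / \<gamma>)"
    unfolding M_def \<gamma>_def by (rule cA_error[OF p d dvd chi ord])
  also have "real p powr (1 - 1 / \<gamma>) = real p * real p powr (- 1 / \<gamma>)"
    using p1 by (simp add: powr_diff powr_minus field_simps)
  also have "11 * real d * (real p * real p powr (- 1 / \<gamma>)) = 11 * (real d * real p) * real p powr (- 1 / \<gamma>)"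
    by simp
  also have "\<dots> \<le> 11 * (3 * M) * (1 / (ln (real p))\<^sup>2)"
    by (rule mult_mono[OF _ small]) (use M in auto)
  finally have "\<bar>cA p chi - M\<bar> / M \<le> 33 / (ln (real p))\<^sup>2" using M by (simp add: field_simps)
  moreover have "\<bar>cA p chi / M - 1\<bar> = \<bar>cA p chi - M\<bar> / M"
    using M by (simp add: abs_if field_simps)
  ultimately show ?thesis unfolding M_def by simp
qed

theorem theorem4p2:
  shows "(\<forall>d::nat. odd d \<and> d > 1 \<longrightarrow> gamma d \<le> d - 1)
    \<and> (\<forall>d::nat. odd d \<and> prime d \<longrightarrow> gamma d = d - 1)
    \<and> (\<exists>C::real. \<forall>(p::nat) (d::nat) chi.
          prime p \<and> odd d \<and> [p = 1] (mod (2 * d)) \<and> dirichlet_char p chi \<and> odd_char p chi \<and>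
          char_order p chi = (p - 1) div d \<longrightarrow>
          \<bar>cA p chi - (2 * real d + 1) / 6 * real p\<bar>
            \<le> C * real d * (ln (real p))\<^sup>2 * real p powr (1 - 1 / real (gamma d)))
    \<and> (\<forall>c::real. c < 1/2 \<longrightarrow> (\<forall>\<epsilon>::real. \<epsilon> > 0 \<longrightarrow> (\<exists>P::nat. \<forall>(p::nat) (d::nat) chi.
          prime p \<and> odd d \<and> [p = 1] (mod (2 * d)) \<and> dirichlet_char p chi \<and> odd_char p chi \<and>
          char_order p chi = (p - 1) div d \<and> p \<ge> P \<and>
          real d \<le> c * ln (real p) / ln (ln (real p)) \<longrightarrow>
          \<bar>cA p chi / ((2 * real d + 1) / 6 * real p) - 1\<bar> < \<epsilon>)))"
proof (intro conjI)
  have dvd: "2 * d dvd p - 1" "d dvd p - 1" if "[p = 1] (mod (2 * d))" for p d :: nat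
    using cong_to_1_nat[OF that] by (auto intro: dvd_mult_right)
  show "\<forall>d::nat. odd d \<and> d > 1 \<longrightarrow> gamma d \<le> d - 1"
  proof (intro allI impI)
    fix d :: nat assume "odd d \<and> d > 1"
    thus "gamma d \<le> d - 1" using totient_less[of d] by (simp add: gamma_eq_totient)
  qed
  show "\<forall>d::nat. odd d \<and> prime d \<longrightarrow> gamma d = d - 1"
    by (auto simp: gamma_eq_totient totient_prime prime_gt_0_nat)
  show "\<exists>C::real. \<forall>(p::nat) (d::nat) chi.
          prime p \<and> odd d \<and> [p = 1] (mod (2 * d)) \<and> dirichlet_char p chi \<and> odd_char p chi \<and>
          char_order p chi = (p - 1) div d \<longrightarrow>
          \<bar>cA p chi - (2 * real d + 1) / 6 * real p\<bar>
            \<le> C * real d * (ln (real p))\<^sup>2 * real p powr (1 - 1 / real (gamma d))"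
  proof (intro exI[of _ 11] allI impI, elim conjE)
    fix p d :: nat and chi
    assume p: "prime p" and d: "odd d" and cong: "[p = 1] (mod (2 * d))"
      and chi: "dirichlet_char p chi" "char_order p chi = (p - 1) div d"
    have "p > 1" using p prime_gt_1_nat by blast
    \<comment> \<open>This forces \<open>p \<ge> 3 \<ge> exp 1\<close>, hence
      \<open>(ln p)^2 \<ge> 1\<close>, and the bound of \<open>cA_error\<close> implies the one with
      the logarithmic factor.\<close>
    have "2 * d \<le> p - 1" using dvd(1)[OF cong] \<open>p > 1\<close> by (intro dvd_imp_le) auto
    hence "p \<ge> 3" using odd_pos[OF d] by linarith
    hence "exp 1 \<le> real p" using exp_le by linarith
    hence "1 \<le> ln (real p)" using \<open>p > 1\<close> by (subst ln_ge_iff) auto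
    hence "1 \<le> (ln (real p))\<^sup>2" by simp
    hence "11 * real d * 1 * real p powr (1 - 1 / real (gamma d))
        \<le> 11 * real d * (ln (real p))\<^sup>2 * real p powr (1 - 1 / real (gamma d))"
      by (intro mult_right_mono mult_left_mono) auto
    thus "\<bar>cA p chi - (2 * real d + 1) / 6 * real p\<bar>
        \<le> 11 * real d * (ln (real p))\<^sup>2 * real p powr (1 - 1 / real (gamma d))"
      using cA_error[OF p d dvd(2)[OF cong] chi] by simp
  qed
  show "\<forall>c::real. c < 1/2 \<longrightarrow> (\<forall>\<epsilon>::real. \<epsilon> > 0 \<longrightarrow> (\<exists>P::nat. \<forall>(p::nat) (d::nat) chi.
          prime p \<and> odd d \<and> [p = 1] (mod (2 * d)) \<and> dirichlet_char p chi \<and> odd_char p chi \<and>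
          char_order p chi = (p - 1) div d \<and> p \<ge> P \<and>
          real d \<le> c * ln (real p) / ln (ln (real p)) \<longrightarrow>
          \<bar>cA p chi / ((2 * real d + 1) / 6 * real p) - 1\<bar> < \<epsilon>))"
  proof (intro allI impI)
    fix c \<epsilon> :: real assume c: "c < 1/2" and \<epsilon>: "\<epsilon> > 0"
    \<comment> \<open>For \<open>p \<ge> exp K\<close> both \<open>ln p > 1\<close> and
      \<open>ln p > 33 / \<epsilon>\<close> hold, so the relative error
      \<open>33 / (ln p)^2 \<le> 33 / ln p\<close> is below \<open>\<epsilon>\<close>.\<close>
    define K where "K = 33 / \<epsilon> + 2"
    show "\<exists>P::nat. \<forall>(p::nat) (d::nat) chi.
          prime p \<and> odd d \<and> [p = 1] (mod (2 * d)) \<and> dirichlet_char p chi \<and> odd_char p chi \<and>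
          char_order p chi = (p - 1) div d \<and> p \<ge> P \<and>
          real d \<le> c * ln (real p) / ln (ln (real p)) \<longrightarrow>
          \<bar>cA p chi / ((2 * real d + 1) / 6 * real p) - 1\<bar> < \<epsilon>"
    proof (intro exI[of _ "nat \<lceil>exp K\<rceil>"] allI impI, elim conjE)
      fix p d :: nat and chi
      assume p: "prime p" and d: "odd d" and cong: "[p = 1] (mod (2 * d))"
        and chi: "dirichlet_char p chi" "char_order p chi = (p - 1) div d"
        and P: "nat \<lceil>exp K\<rceil> \<le> p" and le: "real d \<le> c * ln (real p) / ln (ln (real p))"
      have "exp K \<le> real p" using P by linarith
      hence L: "K \<le> ln (real p)" using p prime_gt_0_nat[of p] by (subst ln_ge_iff) auto
      have "33 / \<epsilon> > 0" using \<epsilon> by simp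
      hence L1: "ln (real p) > 1" and L2: "33 / \<epsilon> < ln (real p)" using L unfolding K_def by linarith+
      \<comment> \<open>Replacing \<open>c\<close> by \<open>1 / 2\<close> enlarges the bound on
        \<open>d\<close>, because \<open>ln p\<close> and \<open>ln (ln p)\<close> are positive; the
        threshold therefore depends on \<open>\<epsilon>\<close> alone.\<close>
      have "c * ln (real p) / ln (ln (real p)) \<le> 1 / 2 * ln (real p) / ln (ln (real p))"
        using c L1 by (intro divide_right_mono mult_right_mono) auto
      hence "real d \<le> ln (real p) / (2 * ln (ln (real p)))" using le by simp
      hence "\<bar>cA p chi / ((2 * real d + 1) / 6 * real p) - 1\<bar> \<le> 33 / (ln (real p))\<^sup>2"
        using cA_relative_error[OF p d dvd(2)[OF cong] chi L1] by blast
      also have "\<dots> < \<epsilon>"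
      proof -
        have "ln (real p) * 1 \<le> (ln (real p))\<^sup>2"
          unfolding power2_eq_square using L1 by (intro mult_left_mono) auto
        hence "33 / \<epsilon> < (ln (real p))\<^sup>2" using L2 by linarith
        thus ?thesis using \<epsilon> L1 by (simp add: field_simps)
      qed
      finally show "\<bar>cA p chi / ((2 * real d + 1) / 6 * real p) - 1\<bar> < \<epsilon>" .
    qed
  qed
qed

end
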